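(* Let $g(z)=\sum_{n\ge1}g_nz^n$ and $f(z)=\sum_{n\ge0}f_nz^n$ be formal power series. Then, as formal power series, \[ f'\!\left(\frac{z}{1-z}\right) g(z)=\sum_{n\ge1} z^n\sum_{\pi\in\mathcal{C}(n)} f_{|\pi|}\sum_{i=1}^{|\pi|} g_{k_i}, \] where for $\pi=(k_1,\dots,k_m)$ the inner sum $\sum_{i=1}^{m}g_{k_i}$ runs over all parts of $\pi$ (counted with multiplicity).
   Context: A composition of $n\ge1$ is a sequence $\pi=(k_1,\dots,k_m)$ of integers $k_i\ge1$ with $k_1+\dots+k_m=n$; $\mathcal{C}(n)$ is the set of compositions of $n$ and $|\pi|=m$ its number of parts. $f'$ denotes the formal derivative of $f$. *)

theory Defs
  imports "HOL-Computational_Algebra.Formal_Power_Series"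
begin

definition compositions :: "nat \<Rightarrow> nat list set" where
  "compositions n = {ks. (\<forall>k\<in>set ks. 1 \<le> k) \<and> sum_list ks = n}"

(* Finiteness ensures that sums over compositions are genuine sums. *)
lemma finite_compositions: "finite (compositions n)"
proof (rule finite_subset)
  have len: "length ks \<le> sum_list ks" if "\<forall>k\<in>set ks. 1 \<le> k" for ks :: "nat list"
    using that by (induction ks) auto
  show "compositions n \<subseteq> {ks. set ks \<subseteq> {..n} \<and> length ks \<le> n}"
    using len member_le_sum_list by (fastforce simp: compositions_def)
  show "finite {ks. set ks \<subseteq> {..n} \<and> length ks \<le> n}"
    by (rule finite_lists_length_le) simp
qed

end

theory Submission imports Defs begin

text \<open>
  Write \<open>P = z / (1 - z)\<close>, whose coefficients are \<open>1\<close> in every positive degree. Splitting off the first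
  part of a composition shows that \<open>P ^ m\<close> counts the compositions with \<open>m\<close> parts, and that the
  generating function \<open>S m\<close> of the sums of the \<open>g k\<close> over the parts of these compositions satisfies
  \<open>S (m + 1) = g * P ^ m + P * S m\<close>. Hence \<open>S (m + 1) = (m + 1) * P ^ m * g\<close>, and weighting with the
  coefficients of \<open>f\<close> turns the factor \<open>m + 1\<close> into the derivative.
\<close>

lemma fps_X_div_one_minus_nth:
  "fps_nth (fps_X / (1 - fps_X) :: 'a::field fps) n = (if n = 0 then 0 else 1)"
proof -
  have "fps_X / (1 - fps_X) = fps_X * inverse (1 - fps_X :: 'a fps)"
    by (rule fps_divide_unit) simp
  also have "inverse (1 - fps_X :: 'a fps) = Abs_fps (\<lambda>n. 1)"
    \<comment> \<open>The geometric series has inverse \<open>1 - fps_X\<close>, so inverting twice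
      recovers it.\<close>
    by (simp add: fps_inverse_gp'[symmetric] fps_inverse_idempotent)
  finally show ?thesis by simp
qed

definition compositions_with_length :: "nat \<Rightarrow> nat \<Rightarrow> nat list set" where
  "compositions_with_length m n = {\<pi> \<in> compositions n. length \<pi> = m}"

lemma finite_compositions_with_length: "finite (compositions_with_length m n)"
  unfolding compositions_with_length_def using finite_compositions by simp

lemma compositions_with_length_0: "compositions_with_length 0 n = (if n = 0 then {[]} else {})"
  by (auto simp: compositions_with_length_def compositions_def)

lemma length_le_composition: "\<pi> \<in> compositions n \<Longrightarrow> length \<pi> \<le> n"
proof -
  have "length ks \<le> sum_list ks" if "\<forall>k\<in>set ks. 1 \<le> k" for ks :: "nat list"
    using that by (induction ks) auto
  then show "\<pi> \<in> compositions n \<Longrightarrow> length \<pi> \<le> n"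
    by (auto simp: compositions_def)
qed

text \<open>Removing the first part \<open>k\<close> leaves a composition of \<open>n - k\<close>
  with one part fewer. The bound \<open>k \<le> n\<close> keeps the natural subtraction
  exact.\<close>

lemma compositions_with_length_Suc:
  "compositions_with_length (Suc m) n =
    (\<Union>k\<in>{1..n}. (#) k ` compositions_with_length m (n - k))"
proof (intro set_eqI iffI)
  fix \<pi> assume "\<pi> \<in> compositions_with_length (Suc m) n"
  then obtain k ks where "\<pi> = k # ks" "1 \<le> k" "\<forall>k\<in>set ks. 1 \<le> k" "k + sum_list ks = n"
    "length ks = m"
    by (cases \<pi>) (auto simp: compositions_with_length_def compositions_def)
  then have "k \<in> {1..n}" "ks \<in> compositions_with_length m (n - k)"
    by (auto simp: compositions_with_length_def compositions_def)
  with \<open>\<pi> = k # ks\<close> show "\<pi> \<in> (\<Union>k\<in>{1..n}. (#) k ` compositions_with_length m (n - k))"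
    by blast
qed (auto simp: compositions_with_length_def compositions_def)

text \<open>The union over first parts is disjoint because the head of a list determines
  \<open>k\<close>, and consing \<open>k\<close> is injective.\<close>

lemma sum_compositions_with_length_Suc:
  fixes F :: "nat list \<Rightarrow> 'a::comm_monoid_add"
  shows "(\<Sum>\<pi>\<in>compositions_with_length (Suc m) n. F \<pi>) =
    (\<Sum>k=1..n. \<Sum>\<pi>\<in>compositions_with_length m (n - k). F (k # \<pi>))"
  unfolding compositions_with_length_Suc
  by (subst sum.UNION_disjoint)
    (auto simp: finite_compositions_with_length sum.reindex intro!: sum.cong)

lemma fps_X_div_one_minus_power_nth:
  "fps_nth ((fps_X / (1 - fps_X) :: 'a::field fps) ^ m) n =
    of_nat (card (compositions_with_length m n))"
proof (induction m arbitrary: n)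
  case 0
  then show ?case by (simp add: compositions_with_length_0)
next
  case (Suc m)
  have "fps_nth ((fps_X / (1 - fps_X) :: 'a fps) ^ Suc m) n =
      (\<Sum>k=0..n. if k = 0 then 0 else of_nat (card (compositions_with_length m (n - k))))"
    by (auto simp: fps_mult_nth fps_X_div_one_minus_nth Suc.IH intro!: sum.cong)
  also have "\<dots> = (\<Sum>k=1..n. of_nat (card (compositions_with_length m (n - k))))"
    by (rule sum.mono_neutral_cong_right) auto
  also have "\<dots> = of_nat (card (compositions_with_length (Suc m) n))"
    using sum_compositions_with_length_Suc[of "\<lambda>_. 1::nat" m n] by simp
  finally show ?case .
qed

lemma sum_over_parts_compositions_with_length:
  fixes g :: "'a::field fps"
  assumes "fps_nth g 0 = 0"
  shows "(\<Sum>\<pi>\<in>compositions_with_length (Suc m) n. sum_list (map (fps_nth g) \<pi>)) =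
    of_nat (Suc m) * fps_nth ((fps_X / (1 - fps_X)) ^ m * g) n"
proof -
  define P :: "'a fps" where "P = fps_X / (1 - fps_X)"
  define S where
    "S m = Abs_fps (\<lambda>n. \<Sum>\<pi>\<in>compositions_with_length m n. sum_list (map (fps_nth g) \<pi>))" for m
  have rec: "S (Suc m) = g * P ^ m + P * S m" for m
  proof (rule fps_ext)
    fix n
    \<comment> \<open>A first part \<open>k\<close> contributes \<open>g k\<close> once for every
      composition of the remainder, hence the cardinality; the remaining parts contribute
      \<open>S m\<close>.\<close>
    have "fps_nth (S (Suc m)) n =
        (\<Sum>k=1..n. fps_nth g k * of_nat (card (compositions_with_length m (n - k))) +
          fps_nth (S m) (n - k))"
      by (simp add: S_def sum_compositions_with_length_Suc sum.distrib mult.commute)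
    \<comment> \<open>The added summand at \<open>k = 0\<close> vanishes, as both \<open>g\<close>
      and \<open>P\<close> have constant term 0.\<close>
    also have "\<dots> = (\<Sum>k=0..n. fps_nth g k * fps_nth (P ^ m) (n - k) +
        fps_nth P k * fps_nth (S m) (n - k))"
      unfolding P_def fps_X_div_one_minus_power_nth
      by (rule sum.mono_neutral_cong_left) (auto simp: fps_X_div_one_minus_nth assms)
    also have "\<dots> = fps_nth (g * P ^ m + P * S m) n"
      by (simp add: fps_mult_nth sum.distrib)
    finally show "fps_nth (S (Suc m)) n = fps_nth (g * P ^ m + P * S m) n" .
  qed
  have "S (Suc m) = of_nat (Suc m) * (P ^ m * g)"
  proof (induction m)
    case 0
    have "S 0 = 0" by (rule fps_ext) (simp add: S_def compositions_with_length_0)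
    then show ?case by (simp add: rec)
  next
    case (Suc m)
    \<comment> \<open>\<open>P * S (Suc m)\<close> yields \<open>Suc m\<close> copies of
      \<open>P ^ Suc m * g\<close>, and the other summand of \<open>rec\<close> is one more.\<close>
    then show ?case by (subst rec) (simp add: algebra_simps)
  qed
  then have "fps_nth (S (Suc m)) n = of_nat (Suc m) * fps_nth (P ^ m * g) n"
    by (metis fps_mult_left_const_nth fps_of_nat)
  then show ?thesis by (simp add: S_def P_def)
qed

text \<open>Since \<open>b ^ i\<close> has no terms below degree \<open>i\<close>, one bound
  \<open>n\<close> serves all coefficients of the composition up to degree \<open>n\<close>, and the
  two finite sums can then be swapped.\<close>

lemma fps_compose_mult_nth:
  fixes a b c :: "'a::comm_ring_1 fps"
  assumes "fps_nth b 0 = 0"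
  shows "fps_nth (fps_compose a b * c) n = (\<Sum>i=0..n. fps_nth a i * fps_nth (b ^ i * c) n)"
proof -
  have "fps_nth (fps_compose a b) j = (\<Sum>i=0..n. fps_nth a i * fps_nth (b ^ i) j)" if "j \<le> n" for j
    unfolding fps_compose_nth using that
    by (intro sum.mono_neutral_left) (auto simp: startsby_zero_power_prefix[OF assms])
  then have "fps_nth (fps_compose a b * c) n =
      (\<Sum>j=0..n. (\<Sum>i=0..n. fps_nth a i * fps_nth (b ^ i) j) * fps_nth c (n - j))"
    by (simp add: fps_mult_nth)
  also have "\<dots> = (\<Sum>i=0..n. fps_nth a i * fps_nth (b ^ i * c) n)"
    unfolding fps_mult_nth sum_distrib_left sum_distrib_right
    by (subst sum.swap) (simp add: mult.assoc)
  finally show ?thesis .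
qed

theorem theorem13:
  fixes f g :: "'a::field fps"
  assumes "fps_nth g 0 = 0"
  shows "fps_compose (fps_deriv f) (fps_X / (1 - fps_X)) * g =
    Abs_fps (\<lambda>n. if n = 0 then 0 else
      (\<Sum>\<pi>\<in>compositions n. fps_nth f (length \<pi>) * (\<Sum>i<length \<pi>. fps_nth g (\<pi> ! i))))"
proof (rule fps_ext)
  fix n
  let ?w = "\<lambda>\<pi>. sum_list (map (fps_nth g) \<pi>)"
  let ?T = "\<lambda>m. \<Sum>\<pi>\<in>compositions_with_length m n. ?w \<pi>"
  have w: "?w \<pi> = (\<Sum>i<length \<pi>. fps_nth g (\<pi> ! i))" for \<pi>
    by (simp add: sum_list_sum_nth atLeast0LessThan)
  \<comment> \<open>The factor \<open>Suc i\<close> in the coefficient of the derivative is absorbed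
    by the sum over compositions with \<open>Suc i\<close> parts.\<close>
  have "fps_nth (fps_compose (fps_deriv f) (fps_X / (1 - fps_X)) * g) n =
      (\<Sum>i=0..n. fps_nth f (Suc i) * ?T (Suc i))"
    by (subst fps_compose_mult_nth)
      (simp_all add: fps_X_div_one_minus_nth sum_over_parts_compositions_with_length[OF assms]
        mult_ac del: of_nat_Suc)
  \<comment> \<open>The new term \<open>m = 0\<close> is zero: at most the empty composition occurs,
    and it has no parts.\<close>
  also have "\<dots> = (\<Sum>m=0..Suc n. fps_nth f m * ?T m)"
    by (subst sum.atLeast0_atMost_Suc_shift) (simp add: compositions_with_length_0)
  also have "\<dots> = (\<Sum>m=0..Suc n. \<Sum>\<pi>\<in>compositions_with_length m n. fps_nth f (length \<pi>) * ?w \<pi>)"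
    unfolding sum_distrib_left
    by (intro sum.cong) (auto simp: compositions_with_length_def)
  \<comment> \<open>Grouping by length exhausts all compositions, since none of \<open>n\<close> has
    more than \<open>n\<close> parts; the group at \<open>Suc n\<close> is empty.\<close>
  also have "\<dots> = (\<Sum>\<pi>\<in>compositions n. fps_nth f (length \<pi>) * ?w \<pi>)"
    unfolding compositions_with_length_def
    by (rule sum.group) (auto simp: finite_compositions dest: length_le_composition)
  finally have "fps_nth (fps_compose (fps_deriv f) (fps_X / (1 - fps_X)) * g) n =
    (\<Sum>\<pi>\<in>compositions n. fps_nth f (length \<pi>) * ?w \<pi>)" .
  \<comment> \<open>In degree 0 only the empty list contributes, with an empty inner sum, which
    agrees with the value 0 prescribed there.\<close>
  moreover have "(\<Sum>\<pi>\<in>compositions 0. fps_nth f (length \<pi>) * ?w \<pi>) = 0"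
    by (intro sum.neutral) (auto dest: length_le_composition)
  ultimately show "fps_nth (fps_compose (fps_deriv f) (fps_X / (1 - fps_X)) * g) n =
    fps_nth (Abs_fps (\<lambda>n. if n = 0 then 0 else
      (\<Sum>\<pi>\<in>compositions n. fps_nth f (length \<pi>) * (\<Sum>i<length \<pi>. fps_nth g (\<pi> ! i))))) n"
    by (simp add: w)
qed

end
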